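(* Let $N,n_u,n_x,n_y,p,n_b,n_t$ be positive integers, and let $\mathbf{y}_k\in\mathbb{R}^{Nn_y}$ be the output of an MS-DeepONet for branch input $\mathbf{u}_k\in\mathbb{R}^{Nn_u}$ and trunk input $x_k\in\mathbb{R}^{n_x}$, that is, $$[\mathbf{y}_k]_i=\left(\mathbf{W}^b_i\,\Phi_b(\mathbf{u}_k)+\boldsymbol{\xi}^b_i\right)^\top\left(\mathbf{W}^t\,\Phi_t(x_k)+\boldsymbol{\zeta}^t\right),\qquad i=1,\dots,Nn_y,$$ where $\mathbf{W}^b_i\in\mathbb{R}^{p\times n_b}$, $\boldsymbol{\xi}^b_i\in\mathbb{R}^p$, $\mathbf{W}^t\in\mathbb{R}^{p\times n_t}$, $\boldsymbol{\zeta}^t\in\mathbb{R}^p$ are the output-layer weights and biases and $\Phi_b(\mathbf{u}_k)\in\mathbb{R}^{n_b}$, $\Phi_t(x_k)\in\mathbb{R}^{n_t}$ are the last hidden layer outputs of the branch and trunk networks. Then there exist a coefficient matrix $\Theta_o$ and a vector $\Phi_\otimes(\mathbf{u}_k,x_k)$ such that $$\mathbf{y}_k=\Theta_o\,\Phi_\otimes(\mathbf{u}_k,x_k):=\Theta_o\begin{bmatrix}\Phi_t(x_k)\otimes\Phi_b(\mathbf{u}_k)\\ \Phi_b(\mathbf{u}_k)\\ \Phi_t(x_k)\\ 1\end{bmatrix},$$ where the coefficient matrix contains all the weights and biases from the branch and trunk output layers, namely $$\Theta_o=\begin{bmatrix}\mathrm{vec}(\mathbf{W}_1^{b\top}\mathbf{W}^t)^\top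 & \boldsymbol{\zeta}^{t\top}\mathbf{W}^b_1 & \boldsymbol{\xi}_1^{b\top}\mathbf{W}^t & \boldsymbol{\xi}_1^{b\top}\boldsymbol{\zeta}^t\\ \vdots&\vdots&\vdots&\vdots\\ \mathrm{vec}(\mathbf{W}_{n_yN}^{b\top}\mathbf{W}^t)^\top & \boldsymbol{\zeta}^{t\top}\mathbf{W}^b_{n_yN} & \boldsymbol{\xi}_{n_yN}^{b\top}\mathbf{W}^t & \boldsymbol{\xi}_{n_yN}^{b\top}\boldsymbol{\zeta}^t\end{bmatrix}.$$
   Context: $[\mathbf{y}]_i$ denotes the $i$-th element of a vector $\mathbf{y}$. $A\otimes B$ is the Kronecker product, i.e. the block matrix with $(i,j)$ block $a_{i,j}B$. $\mathrm{vec}(A)$ stacks the columns of $A$ into a single column vector, e.g. $\mathrm{vec}\begin{bmatrix}a&b\\c&d\end{bmatrix}=\mathrm{col}(a,c,b,d)$. The maps $\Phi_b:\mathbb{R}^{Nn_u}\to\mathbb{R}^{n_b}$ and $\Phi_t:\mathbb{R}^{n_x}\to\mathbb{R}^{n_t}$ collect the outputs of the last hidden layers of the MS-DeepONet's branch and trunk feedforward networks; for this statement they may be regarded as arbitrary functions. *)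

theory Defs
  imports Complex_Main "HOL-Library.FuncSet" "Jordan_Normal_Form.Matrix"
begin

text \<open>
  Elements of R^n and of R^{m x n} are elements of \<^term>\<open>carrier_vec n :: real vec set\<close> and of
  \<^term>\<open>carrier_mat m n :: real mat set\<close>. All indices start at 0, so the output channels
  are numbered \<open>0, \<dots>, N * n\<^sub>y - 1\<close>.
\<close>

definition kronecker :: "'a :: semiring_0 mat \<Rightarrow> 'a mat \<Rightarrow> 'a mat" where
  "kronecker A B = mat (dim_row A * dim_row B) (dim_col A * dim_col B)
     (\<lambda>(r, c). A $$ (r div dim_row B, c div dim_col B) * B $$ (r mod dim_row B, c mod dim_col B))"

lemma kronecker_block:
  assumes "i < dim_row A" "j < dim_col A" "k < dim_row B" "l < dim_col B"
  shows "kronecker A B $$ (i * dim_row B + k, j * dim_col B + l) = (A $$ (i, j) \<cdot>\<^sub>m B) $$ (k, l)"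
proof -
  have bound: "a * n + b < m * n" if "a < m" "b < n" for a b m n :: nat
  proof -
    have "a * n + b < Suc a * n" using that by simp
    also have "\<dots> \<le> m * n" using that by (intro mult_right_mono) auto
    finally show ?thesis .
  qed
  show ?thesis using assms by (simp add: kronecker_def bound)
qed

text \<open>The Kronecker product of two vectors, both read as one-column matrices.\<close>

definition kronecker_vec :: "'a :: semiring_0 vec \<Rightarrow> 'a vec \<Rightarrow> 'a vec" where
  "kronecker_vec v w =
     col (kronecker (mat_of_cols (dim_vec v) [v]) (mat_of_cols (dim_vec w) [w])) 0"

text \<open>The vec operator, stacking the columns of a matrix.\<close>

definition vectorize :: "'a mat \<Rightarrow> 'a vec" where
  "vectorize A = vec (dim_col A * dim_row A)
     (\<lambda>k. col A (k div dim_row A) $ (k mod dim_row A))"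

lemma vectorize_example:
  "vectorize (mat_of_rows_list 2 [[a, b], [c, d]]) = vec_of_list [a, c, b, d]"
proof (rule eq_vecI)
  fix k assume "k < dim_vec (vec_of_list [a, c, b, d])"
  then have "k = 0 \<or> k = 1 \<or> k = 2 \<or> k = 3" by auto
  then show "vectorize (mat_of_rows_list 2 [[a, b], [c, d]]) $ k = vec_of_list [a, c, b, d] $ k"
    by (auto simp: vectorize_def mat_of_rows_list_def div_Suc mod_Suc numeral_eq_Suc)
qed (simp add: vectorize_def mat_of_rows_list_def)

text \<open>The product \<open>v\<^sup>T A\<close> of a row vector and a matrix.\<close>

definition mult_vec_mat :: "'a :: semiring_0 vec \<Rightarrow> 'a mat \<Rightarrow> 'a vec"
    (infixl \<open>\<^sub>v*\<close> 70) where
  "v \<^sub>v* A = vec (dim_col A) (\<lambda>j. v \<bullet> col A j)"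

text \<open>
  Output of an MS-DeepONet with \<open>m\<close> output channels. \<open>\<Phi>b\<close> and \<open>\<Phi>t\<close> are the maps from the inputs
  to the last hidden layers of the branch and trunk networks; the remaining arguments are
  the weights and biases of the two output layers.
\<close>

definition ms_deeponet ::
    "nat \<Rightarrow> (real vec \<Rightarrow> real vec) \<Rightarrow> (real vec \<Rightarrow> real vec) \<Rightarrow> (nat \<Rightarrow> real mat) \<Rightarrow> (nat \<Rightarrow> real vec) \<Rightarrow>
     real mat \<Rightarrow> real vec \<Rightarrow> real vec \<Rightarrow> real vec \<Rightarrow> real vec" where
  "ms_deeponet m \<Phi>b \<Phi>t Wb \<xi>b Wt \<zeta>t u x =
     vec m (\<lambda>i. (Wb i *\<^sub>v \<Phi>b u + \<xi>b i) \<bullet> (Wt *\<^sub>v \<Phi>t x + \<zeta>t))"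

definition coeff_row :: "real mat \<Rightarrow> real vec \<Rightarrow> real mat \<Rightarrow> real vec \<Rightarrow> real vec" where
  "coeff_row W \<xi> Wt \<zeta>t =
     vectorize (transpose_mat W * Wt) @\<^sub>v (\<zeta>t \<^sub>v* W) @\<^sub>v (\<xi> \<^sub>v* Wt) @\<^sub>v vec_of_list [\<xi> \<bullet> \<zeta>t]"

definition coeff_mat ::
    "nat \<Rightarrow> nat \<Rightarrow> nat \<Rightarrow> (nat \<Rightarrow> real mat) \<Rightarrow> (nat \<Rightarrow> real vec) \<Rightarrow> real mat \<Rightarrow> real vec \<Rightarrow> real mat" where
  "coeff_mat m n\<^sub>b n\<^sub>t Wb \<xi>b Wt \<zeta>t =
     mat_of_rows (n\<^sub>t * n\<^sub>b + n\<^sub>b + n\<^sub>t + 1) (map (\<lambda>i. coeff_row (Wb i) (\<xi>b i) Wt \<zeta>t) [0..<m])"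

end

theory Submission
  imports Defs
begin

text \<open>
  An output channel is a product of two affine expressions in the hidden features
  \<open>b\<close> (branch) and \<open>t\<close> (trunk), so it is a bilinear form in \<open>(b, t)\<close> plus a linear term in
  each argument plus a constant:
  \<open>(W b + \<xi>) \<bullet> (W\<^sub>t t + \<zeta>) = b \<bullet> (W\<^sup>T W\<^sub>t t) + (\<zeta>\<^sup>T W) \<bullet> b + (\<xi>\<^sup>T W\<^sub>t) \<bullet> t + \<xi> \<bullet> \<zeta>\<close>.
  Each term is linear in one of the four stacked features. This is immediate for the last
  three. For the first, the entries of \<open>t \<otimes> b\<close> are exactly the monomials \<open>t\<^sub>j b\<^sub>i\<close>, listed in
  the order in which vec lists the coefficients of a bilinear form
  (\<open>vectorize_scalar_prod_kronecker_vec\<close>). The four coefficient blocks do not involve the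
  inputs, which is why one matrix serves all \<open>u\<close> and \<open>x\<close>; \<open>coeff_row_scalar_prod\<close> is the
  resulting identity for one channel.
\<close>

lemma dim_kronecker_vec: "dim_vec (kronecker_vec v w) = dim_vec v * dim_vec w"
  by (simp add: kronecker_vec_def kronecker_def)

lemma kronecker_vec_index:
  assumes "k < dim_vec v * dim_vec w"
  shows "kronecker_vec v w $ k = v $ (k div dim_vec w) * w $ (k mod dim_vec w)"
proof -
  have "0 < dim_vec w" using assms by (cases "dim_vec w") auto
  moreover have "k div dim_vec w < dim_vec v"
    using assms by (simp add: less_mult_imp_div_less)
  ultimately show ?thesis
    using assms by (simp add: kronecker_vec_def kronecker_def mat_of_cols_def)
qed

text \<open>
  The order of the Kronecker factors matters: at position \<open>j n + i\<close> with \<open>i < n\<close>, vec has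
  \<open>A\<^sub>i\<^sub>j\<close> and \<open>v \<otimes> w\<close> has \<open>v\<^sub>j w\<^sub>i\<close>. Cutting the positions into blocks of length \<open>n\<close>, one
  for each column of \<open>A\<close>, therefore gives the double sum \<open>\<Sum>\<^sub>j \<Sum>\<^sub>i A\<^sub>i\<^sub>j v\<^sub>j w\<^sub>i\<close>.
\<close>

lemma vectorize_scalar_prod_kronecker_vec:
  fixes A :: "'a :: comm_semiring_0 mat"
  assumes A: "A \<in> carrier_mat n m" and v: "v \<in> carrier_vec m" and w: "w \<in> carrier_vec n"
  shows "vectorize A \<bullet> kronecker_vec v w = w \<bullet> (A *\<^sub>v v)"
proof -
  let ?f = "\<lambda>k. A $$ (k mod n, k div n) * (v $ (k div n) * w $ (k mod n))"
  have "vectorize A \<bullet> kronecker_vec v w = sum ?f {..<m * n}"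
    unfolding scalar_prod_def
  proof (rule sum.cong)
    fix k assume "k \<in> {..<m * n}"
    then have k: "k < m * n" by simp
    then have "0 < n" by (cases n) auto
    moreover have "k div n < m" using k by (simp add: less_mult_imp_div_less)
    ultimately show "vectorize A $ k * kronecker_vec v w $ k = ?f k"
      using A v w k by (simp add: vectorize_def kronecker_vec_index)
  qed (use v w in \<open>auto simp: dim_kronecker_vec\<close>)
  also have "\<dots> = (\<Sum>j<m. sum ?f {j * n..<j * n + n})"
    by (simp add: sum.nat_group)
  also have "\<dots> = (\<Sum>j<m. \<Sum>i<n. A $$ (i, j) * (v $ j * w $ i))"
  proof (rule sum.cong[OF refl])
    fix j
    have "sum ?f {j * n..<j * n + n} = (\<Sum>i<n. ?f (i + j * n))"
      using sum.shift_bounds_nat_ivl[of ?f 0 "j * n" n] by (simp add: add.commute lessThan_atLeast0)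
    also have "\<dots> = (\<Sum>i<n. A $$ (i, j) * (v $ j * w $ i))"
      by (rule sum.cong) auto
    finally show "sum ?f {j * n..<j * n + n} = (\<Sum>i<n. A $$ (i, j) * (v $ j * w $ i))" .
  qed
  also have "\<dots> = (\<Sum>i<n. \<Sum>j<m. w $ i * (A $$ (i, j) * v $ j))"
    by (subst sum.swap) (simp add: mult.commute mult.left_commute)
  also have "\<dots> = w \<bullet> (A *\<^sub>v v)"
    using A v w by (simp add: scalar_prod_def lessThan_atLeast0 sum_distrib_left)
  finally show ?thesis .
qed

lemma mult_vec_mat_eq_transpose:
  fixes A :: "'a :: comm_semiring_0 mat"
  assumes "A \<in> carrier_mat n m" "v \<in> carrier_vec n"
  shows "v \<^sub>v* A = transpose_mat A *\<^sub>v v"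
proof (rule eq_vecI)
  fix i assume "i < dim_vec (transpose_mat A *\<^sub>v v)"
  then show "(v \<^sub>v* A) $ i = (transpose_mat A *\<^sub>v v) $ i"
    using assms comm_scalar_prod[of v n "col A i"] by (simp add: mult_vec_mat_def)
qed (simp add: mult_vec_mat_def)

text \<open>Associativity of the product \<open>v\<^sup>T A w\<close>, turning a
  coefficient block that acts on one feature vector into a cross term of the expanded product.\<close>

lemma mult_vec_mat_scalar_prod:
  fixes A :: "'a :: comm_semiring_0 mat"
  assumes "A \<in> carrier_mat n m" "v \<in> carrier_vec n" "w \<in> carrier_vec m"
  shows "(v \<^sub>v* A) \<bullet> w = v \<bullet> (A *\<^sub>v w)"
  unfolding mult_vec_mat_eq_transpose[OF assms(1,2)]
  using assms by (intro transpose_vec_mult_scalar)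

text \<open>
  Moving \<open>A\<close> across the product exposes the matrix of the bilinear form, which is what vec
  has to be applied to.
\<close>

lemma mult_mat_vec_scalar_prod_mult_mat_vec:
  fixes A B :: "'a :: comm_semiring_0 mat"
  assumes A: "A \<in> carrier_mat p n" and B: "B \<in> carrier_mat p m"
    and v: "v \<in> carrier_vec n" and w: "w \<in> carrier_vec m"
  shows "(A *\<^sub>v v) \<bullet> (B *\<^sub>v w) = v \<bullet> (transpose_mat A * B *\<^sub>v w)"
proof -
  have "(A *\<^sub>v v) \<bullet> (B *\<^sub>v w) = (B *\<^sub>v w) \<bullet> (A *\<^sub>v v)"
    using A B v w by (intro comm_scalar_prod[of _ p]) auto
  also have "\<dots> = (transpose_mat A *\<^sub>v (B *\<^sub>v w)) \<bullet> v"
    using transpose_vec_mult_scalar[of A p n v "B *\<^sub>v w"] A B v w by simp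
  also have "\<dots> = (transpose_mat A * B *\<^sub>v w) \<bullet> v"
    using assoc_mult_mat_vec[of "transpose_mat A" n p B m w] A B w by simp
  also have "\<dots> = v \<bullet> (transpose_mat A * B *\<^sub>v w)"
    using A B v w by (intro comm_scalar_prod[of _ n]) auto
  finally show ?thesis .
qed

lemma coeff_row_carrier:
  assumes "W \<in> carrier_mat p n" "Wt \<in> carrier_mat p m"
  shows "coeff_row W \<xi> Wt \<zeta> \<in> carrier_vec (m * n + n + m + 1)"
  using assms by (intro carrier_vecI) (simp add: coeff_row_def vectorize_def mult_vec_mat_def)

text \<open>
  The product of two appended vectors splits block by block; the four partial products are the
  four terms of the expanded product of affine expressions.
\<close>

lemma coeff_row_scalar_prod:
  assumes W: "W \<in> carrier_mat p n" and Wt: "Wt \<in> carrier_mat p m"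
    and \<xi>: "\<xi> \<in> carrier_vec p" and \<zeta>: "\<zeta> \<in> carrier_vec p"
    and b: "b \<in> carrier_vec n" and t: "t \<in> carrier_vec m"
  shows "coeff_row W \<xi> Wt \<zeta> \<bullet> (kronecker_vec t b @\<^sub>v b @\<^sub>v t @\<^sub>v vec_of_list [1])
    = (W *\<^sub>v b + \<xi>) \<bullet> (Wt *\<^sub>v t + \<zeta>)"
proof -
  have one: "vec_of_list [c] \<in> carrier_vec 1" for c :: real
    by (rule carrier_vecI) simp
  have V: "vectorize (transpose_mat W * Wt) \<in> carrier_vec (m * n)"
    and K: "kronecker_vec t b \<in> carrier_vec (m * n)"
    and R: "\<zeta> \<^sub>v* W \<in> carrier_vec n" "\<xi> \<^sub>v* Wt \<in> carrier_vec m"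
    using W Wt b t
    by (auto simp: vectorize_def mult_vec_mat_def dim_kronecker_vec intro!: carrier_vecI)
  have "coeff_row W \<xi> Wt \<zeta> \<bullet> (kronecker_vec t b @\<^sub>v b @\<^sub>v t @\<^sub>v vec_of_list [1])
    = vectorize (transpose_mat W * Wt) \<bullet> kronecker_vec t b
      + ((\<zeta> \<^sub>v* W) \<bullet> b + ((\<xi> \<^sub>v* Wt) \<bullet> t + vec_of_list [\<xi> \<bullet> \<zeta>] \<bullet> vec_of_list [1]))"
    unfolding coeff_row_def
      scalar_prod_append[OF V append_carrier_vec[OF R(1) append_carrier_vec[OF R(2) one]]
        K append_carrier_vec[OF b append_carrier_vec[OF t one]]]
      scalar_prod_append[OF R(1) append_carrier_vec[OF R(2) one] b append_carrier_vec[OF t one]]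
      scalar_prod_append[OF R(2) one t one] ..
  also have "vec_of_list [\<xi> \<bullet> \<zeta>] \<bullet> vec_of_list [1] = \<xi> \<bullet> \<zeta>"
    by (simp add: scalar_prod_def)
  also have "vectorize (transpose_mat W * Wt) \<bullet> kronecker_vec t b = (W *\<^sub>v b) \<bullet> (Wt *\<^sub>v t)"
    using vectorize_scalar_prod_kronecker_vec[of "transpose_mat W * Wt" n m t b]
      mult_mat_vec_scalar_prod_mult_mat_vec[OF W Wt b t] W Wt b t by simp
  also have "(\<zeta> \<^sub>v* W) \<bullet> b = (W *\<^sub>v b) \<bullet> \<zeta>"
    using mult_vec_mat_scalar_prod[OF W \<zeta> b] comm_scalar_prod[of \<zeta> p "W *\<^sub>v b"] W \<zeta> b by simp
  also have "(\<xi> \<^sub>v* Wt) \<bullet> t = \<xi> \<bullet> (Wt *\<^sub>v t)"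
    using mult_vec_mat_scalar_prod[OF Wt \<xi> t] .
  also have "(W *\<^sub>v b) \<bullet> (Wt *\<^sub>v t) + ((W *\<^sub>v b) \<bullet> \<zeta> + (\<xi> \<bullet> (Wt *\<^sub>v t) + \<xi> \<bullet> \<zeta>))
    = (W *\<^sub>v b + \<xi>) \<bullet> (Wt *\<^sub>v t + \<zeta>)"
    using W Wt \<xi> \<zeta> b t
    by (simp add: add_scalar_prod_distrib[of _ p] scalar_prod_add_distrib[of _ p])
  finally show ?thesis .
qed

theorem lemma1:
  fixes N n\<^sub>u n\<^sub>x n\<^sub>y p n\<^sub>b n\<^sub>t :: nat
    and \<Phi>b \<Phi>t :: "real vec \<Rightarrow> real vec"
    and Wb :: "nat \<Rightarrow> real mat" and \<xi>b :: "nat \<Rightarrow> real vec"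
    and Wt :: "real mat" and \<zeta>t :: "real vec"
  assumes "N > 0" "n\<^sub>u > 0" "n\<^sub>x > 0" "n\<^sub>y > 0" "p > 0" "n\<^sub>b > 0" "n\<^sub>t > 0"
    and "\<Phi>b \<in> carrier_vec (N * n\<^sub>u) \<rightarrow> carrier_vec n\<^sub>b"
    and "\<Phi>t \<in> carrier_vec n\<^sub>x \<rightarrow> carrier_vec n\<^sub>t"
    and "\<And>i. i < N * n\<^sub>y \<Longrightarrow> Wb i \<in> carrier_mat p n\<^sub>b"
    and "\<And>i. i < N * n\<^sub>y \<Longrightarrow> \<xi>b i \<in> carrier_vec p"
    and "Wt \<in> carrier_mat p n\<^sub>t"
    and "\<zeta>t \<in> carrier_vec p"
  shows "\<exists>\<Theta>\<^sub>o \<in> carrier_mat (N * n\<^sub>y) (n\<^sub>t * n\<^sub>b + n\<^sub>b + n\<^sub>t + 1).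
         \<exists>\<Phi>kr :: real vec \<Rightarrow> real vec \<Rightarrow> real vec.
           \<Theta>\<^sub>o = coeff_mat (N * n\<^sub>y) n\<^sub>b n\<^sub>t Wb \<xi>b Wt \<zeta>t \<and>
           (\<forall>u \<in> carrier_vec (N * n\<^sub>u). \<forall>x \<in> carrier_vec n\<^sub>x.
              \<Phi>kr u x = kronecker_vec (\<Phi>t x) (\<Phi>b u) @\<^sub>v \<Phi>b u @\<^sub>v \<Phi>t x @\<^sub>v vec_of_list [1] \<and>
              \<Phi>kr u x \<in> carrier_vec (n\<^sub>t * n\<^sub>b + n\<^sub>b + n\<^sub>t + 1) \<and>
              ms_deeponet (N * n\<^sub>y) \<Phi>b \<Phi>t Wb \<xi>b Wt \<zeta>t u x = \<Theta>\<^sub>o *\<^sub>v \<Phi>kr u x)"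
proof (intro bexI exI conjI ballI)
  let ?\<Theta> = "coeff_mat (N * n\<^sub>y) n\<^sub>b n\<^sub>t Wb \<xi>b Wt \<zeta>t"
  let ?\<Phi> = "\<lambda>u x. kronecker_vec (\<Phi>t x) (\<Phi>b u) @\<^sub>v \<Phi>b u @\<^sub>v \<Phi>t x @\<^sub>v vec_of_list [1]"
  show "?\<Theta> = ?\<Theta>" ..
  show "?\<Theta> \<in> carrier_mat (N * n\<^sub>y) (n\<^sub>t * n\<^sub>b + n\<^sub>b + n\<^sub>t + 1)"
    by (intro carrier_matI) (simp_all add: coeff_mat_def)
  fix u x :: "real vec"
  assume u: "u \<in> carrier_vec (N * n\<^sub>u)" and x: "x \<in> carrier_vec n\<^sub>x"
  have b: "\<Phi>b u \<in> carrier_vec n\<^sub>b" using assms(8) u by auto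
  have t: "\<Phi>t x \<in> carrier_vec n\<^sub>t" using assms(9) x by auto
  show "?\<Phi> u x = ?\<Phi> u x" ..
  show "?\<Phi> u x \<in> carrier_vec (n\<^sub>t * n\<^sub>b + n\<^sub>b + n\<^sub>t + 1)"
    using b t by (intro carrier_vecI) (simp add: dim_kronecker_vec)
  show "ms_deeponet (N * n\<^sub>y) \<Phi>b \<Phi>t Wb \<xi>b Wt \<zeta>t u x = ?\<Theta> *\<^sub>v ?\<Phi> u x"
  proof (rule eq_vecI)
    fix i assume "i < dim_vec (?\<Theta> *\<^sub>v ?\<Phi> u x)"
    then have i: "i < N * n\<^sub>y" by (simp add: coeff_mat_def)
    then have "row ?\<Theta> i = coeff_row (Wb i) (\<xi>b i) Wt \<zeta>t"
      using coeff_row_carrier[OF assms(10)[OF i] assms(12)] by (simp add: coeff_mat_def)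
    then show "ms_deeponet (N * n\<^sub>y) \<Phi>b \<Phi>t Wb \<xi>b Wt \<zeta>t u x $ i = (?\<Theta> *\<^sub>v ?\<Phi> u x) $ i"
      using coeff_row_scalar_prod[OF assms(10)[OF i] assms(12) assms(11)[OF i] assms(13) b t] i
      by (simp add: ms_deeponet_def coeff_mat_def)
  qed (simp add: ms_deeponet_def coeff_mat_def)
qed

end
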